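(* Let $c>0$ and $\lambda>0$ be constants, let $N(t)$, $t\geqslant 0$, be a homogeneous (stationary) Poisson process with intensity $\lambda$ and $N(0)=0$, and put $\chi(t)=\tfrac12\bigl(1+\cos[\pi N(t)]\bigr)$. Let $x(t)$ be the process with $x(0)=0$ and $dx(t)=(2\chi(t)-1)\,c\,dt$, i.e. $x(t)=\int_0^t \cos[\pi N(\tau)]\,c\,d\tau$. For $\beta\in\mathbb{R}$ let $$I(t)=E\bigl[e^{i\beta x(t)}\bigr]=E\Bigl[\exp\Bigl\{i\beta\int_0^t\cos[\pi N(\tau)]\,c\,d\tau\Bigr\}\Bigr]$$ be the characteristic function of $x(t)$. Then for every $\beta\in\mathbb{R}$, $I$ is a solution, as a function of $t\geqslant 0$, of the Cauchy problem $$\frac{d^{2}I(t)}{dt^{2}}+2\lambda\frac{dI(t)}{dt}+c^{2}\beta^{2}I(t)=0,\qquad I(0)=1,\qquad \frac{dI}{dt}(0)=ic\beta .$$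
   Context: $E$ denotes mathematical expectation. The process $x(t)$ describes one-dimensional motion of a particle with constant speed $c$ whose direction of motion is reversed at the jump times of the Poisson process $N$ (the Kac model). Derivatives at $t=0$ are one-sided. *)

theory Defs
  imports "HOL-Probability.Probability"
begin

text \<open>
  Only times \<open>t \<ge> 0\<close> are constrained; the values of \<open>N\<close> at negative times are irrelevant.
  As usual for counting processes, the path conditions hold for every sample point.
  The type \<^typ>\<open>nat\<close> carries the discrete topology, so right-continuity means that
  the path is locally constant to the right of each time. Since paths are nondecreasing,
  the truncated subtraction in the increments is the ordinary one.
\<close>

locale poisson_process = prob_space M
  for M :: "'a measure" and rate :: real and N :: "real \<Rightarrow> 'a \<Rightarrow> nat" +
  assumes rate_pos: "0 < rate"
    and measurable_N: "\<And>t. 0 \<le> t \<Longrightarrow> random_variable (count_space UNIV) (N t)"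
    and N_0: "\<And>\<omega>. \<omega> \<in> space M \<Longrightarrow> N 0 \<omega> = 0"
    and paths_mono: "\<And>\<omega>. \<omega> \<in> space M \<Longrightarrow> mono_on {0..} (\<lambda>t. N t \<omega>)"
    and paths_right_continuous:
      "\<And>\<omega> t. \<omega> \<in> space M \<Longrightarrow> 0 \<le> t \<Longrightarrow> continuous (at_right t) (\<lambda>s. N s \<omega>)"
    and increments_indep:
      "\<And>(n::nat) t. 0 \<le> t 0 \<Longrightarrow> strict_mono_on {..n} t \<Longrightarrow>
         indep_vars (\<lambda>_. count_space UNIV) (\<lambda>k \<omega>. N (t (Suc k)) \<omega> - N (t k) \<omega>) {..<n}"
    and increments_poisson:
      "\<And>s t. 0 \<le> s \<Longrightarrow> s < t \<Longrightarrow>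
         distr M (count_space UNIV) (\<lambda>\<omega>. N t \<omega> - N s \<omega>) = measure_pmf (poisson_pmf (rate * (t - s)))"

definition kac_chi :: "(real \<Rightarrow> 'a \<Rightarrow> nat) \<Rightarrow> real \<Rightarrow> 'a \<Rightarrow> real" where
  "kac_chi N t \<omega> = (1 + cos (pi * real (N t \<omega>))) / 2"

definition kac_position :: "real \<Rightarrow> (real \<Rightarrow> 'a \<Rightarrow> nat) \<Rightarrow> real \<Rightarrow> 'a \<Rightarrow> real" where
  "kac_position c N t \<omega> = (LBINT \<tau>:{0..t}. (2 * kac_chi N \<tau> \<omega> - 1) * c)"

lemma kac_position_eq:
  "kac_position c N t \<omega> = (LBINT \<tau>:{0..t}. cos (pi * real (N \<tau> \<omega>)) * c)"
proof -
  have "2 * kac_chi N \<tau> \<omega> - 1 = cos (pi * real (N \<tau> \<omega>))" for \<tau>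
    unfolding kac_chi_def by (simp only: times_divide_eq_right) (simp add: field_simps)
  then show ?thesis by (simp only: kac_position_def)
qed

definition kac_char ::
  "'a measure \<Rightarrow> real \<Rightarrow> (real \<Rightarrow> 'a \<Rightarrow> nat) \<Rightarrow> real \<Rightarrow> real \<Rightarrow> complex" where
  "kac_char M c N \<beta> t = (\<integral>\<omega>. exp (\<i> * of_real (\<beta> * kac_position c N t \<omega>)) \<partial>M)"

end

theory Submission
  imports Defs
begin

text \<open>
  Write \<open>s(t) = (-1)^N(t)\<close>, \<open>X(t)\<close> for the integral of \<open>s\<close> over \<open>[0, t]\<close>, \<open>e(t) = cis (a X(t))\<close> with
  \<open>a = \<beta> c\<close>, \<open>u(t) = E[e(t)]\<close> and \<open>v(t) = E[s(t) e(t)]\<close>. Along every path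
  \<open>e(t) = 1 + \<i> a \<integral>\<^sub>0\<^sup>t s(r) e(r) dr\<close>. Taking expectations gives \<open>u = 1 + \<i> a \<integral> v\<close>; multiplying by \<open>s(t)\<close>
  first and using that \<open>s(t) s(r)\<close> is independent of \<open>e(r)\<close> with mean \<open>exp (-2 \<lambda> (t - r))\<close> gives
  \<open>v(t) = exp (-2 \<lambda> t) (1 + \<i> a \<integral>\<^sub>0\<^sup>t exp (2 \<lambda> r) u(r) dr)\<close>. Hence \<open>u' = \<i> a v\<close> and \<open>v' = \<i> a u - 2 \<lambda> v\<close>.
\<close>

section \<open>Auxiliary facts: grid sums, bounded integrands, mean parity of a Poisson
  variable\<close>

text \<open>
  A path jumps in at most \<open>n (m h)\<close> cells of the grid with mesh \<open>h\<close>, so an interval functional that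
  vanishes on jump-free cells has total \<open>O(h)\<close>. This replaces an enumeration of the jump times.
\<close>

lemma counting_grid_bound:
  fixes n :: "real \<Rightarrow> nat" and R :: "real \<Rightarrow> real \<Rightarrow> 'b::real_normed_vector"
  assumes mono: "mono_on {0..} n" and h: "0 \<le> h"
    and const: "\<And>s t. 0 \<le> s \<Longrightarrow> s \<le> t \<Longrightarrow> n s = n t \<Longrightarrow> R s t = 0"
    and bound: "\<And>s t. 0 \<le> s \<Longrightarrow> s \<le> t \<Longrightarrow> norm (R s t) \<le> C * (t - s)"
  shows "norm (\<Sum>k<m. R (real k * h) (real (Suc k) * h)) \<le> C * h * real (n (real m * h))"
proof (induction m)
  case (Suc m)
  have C: "0 \<le> C" using order_trans[OF norm_ge_zero bound[of 0 1]] by simp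
  have le: "real m * h \<le> real (Suc m) * h" using h by (intro mult_right_mono) auto
  have n: "n (real m * h) \<le> n (real (Suc m) * h)"
    by (intro mono_onD[OF mono] le) (use h in auto)
  have "norm (R (real m * h) (real (Suc m) * h))
      \<le> C * h * real (n (real (Suc m) * h) - n (real m * h))"
  proof (cases "n (real m * h) = n (real (Suc m) * h)")
    case True
    then show ?thesis using const[OF _ le] h by simp
  next
    case False
    have "norm (R (real m * h) (real (Suc m) * h)) \<le> C * h * 1"
      using bound[OF _ le] h by (simp add: algebra_simps)
    also have "\<dots> \<le> C * h * real (n (real (Suc m) * h) - n (real m * h))"
      using False n C h by (intro mult_left_mono) auto
    finally show ?thesis .
  qed
  then show ?case
    using Suc n by (auto simp: of_nat_diff right_diff_distrib intro: norm_triangle_le)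
qed (use order_trans[OF norm_ge_zero bound[of 0 1]] h in simp)

lemma set_integrable_bounded_Icc:
  fixes g :: "real \<Rightarrow> 'b::{banach, second_countable_topology}"
  assumes "g \<in> borel_measurable borel" and "\<And>x. norm (g x) \<le> B"
  shows "set_integrable lborel {a..b} g"
  unfolding set_integrable_def
proof (rule Bochner_Integration.integrable_bound)
  have "integrable lborel (indicator {a..b} :: real \<Rightarrow> real)" by (auto simp: emeasure_lborel_Icc_eq)
  then show "integrable lborel (\<lambda>x. indicator {a..b} x * B)" by (rule integrable_mult_left)
qed (use assms order_trans[OF norm_ge_zero assms(2)] in \<open>auto simp: indicator_def\<close>)

text \<open>The probability generating function \<open>exp (r * (z - 1))\<close> at
  \<open>z = -1\<close>: the weights with alternating signs form the series of
  \<open>exp (- r)\<close>, times the normalization \<open>exp (- r)\<close>. The series is summed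
  over the reals and then cast to the complex numbers.\<close>

lemma expectation_minus_one_power_poisson:
  assumes "0 < r"
  shows "(\<integral>k. (-1) ^ k \<partial>measure_pmf (poisson_pmf r)) = (exp (- (2 * r)) :: complex)"
proof -
  let ?f = "\<lambda>k::nat. (-1) ^ k :: real"
  have "(\<lambda>k. (- r) ^ k / fact k * exp (- r)) sums (exp (- r) * exp (- r))"
    using sums_mult2[OF exp_converges[of "- r"], of "exp (- r)"]
    by (simp add: divide_inverse mult.commute)
  moreover have int: "integrable (count_space UNIV) (\<lambda>k. pmf (poisson_pmf r) k *\<^sub>R ?f k)"
    by (rule Bochner_Integration.integrable_bound[OF integrable_pmf[of UNIV "poisson_pmf r"]]) (auto simp: abs_mult)
  moreover have "pmf (poisson_pmf r) k *\<^sub>R ?f k = (- r) ^ k / fact k * exp (- r)" for k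
    using assms by (simp add: power_minus[of r])
  ultimately have "integral\<^sup>L (count_space UNIV) (\<lambda>k. pmf (poisson_pmf r) k *\<^sub>R ?f k) = exp (- r) * exp (- r)"
    using sums_integral_count_space_nat[OF int] by (auto dest: sums_unique2)
  moreover have "(\<integral>k. ?f k \<partial>measure_pmf (poisson_pmf r)) = integral\<^sup>L (count_space UNIV) (\<lambda>k. pmf (poisson_pmf r) k *\<^sub>R ?f k)"
    unfolding measure_pmf_eq_density by (rule integral_density) auto
  ultimately have "(\<integral>k. ?f k \<partial>measure_pmf (poisson_pmf r)) = exp (- (2 * r))"
    by (simp flip: exp_add)
  moreover have "(\<integral>k. (-1) ^ k \<partial>measure_pmf (poisson_pmf r)) = complex_of_real (\<integral>k. ?f k \<partial>measure_pmf (poisson_pmf r))"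
    by (simp flip: integral_complex_of_real)
  ultimately show ?thesis by (simp add: exp_of_real)
qed

section \<open>Sign process, displacement and phase; joint measurability in time and sample
  point\<close>

context poisson_process
begin

text \<open>The truncation at \<open>0\<close> makes measurability unconditional, as \<open>N\<close> is arbitrary at negative times.\<close>

definition direction :: "real \<Rightarrow> 'a \<Rightarrow> real" where
  "direction t \<omega> = (-1) ^ N (max 0 t) \<omega>"

definition displacement :: "real \<Rightarrow> 'a \<Rightarrow> real" where
  "displacement t \<omega> = (LBINT s:{0..t}. direction s \<omega>)"

text \<open>The displacement is that of unit-speed motion; the speed enters only through
  \<open>a\<close>, later taken as \<open>\<beta> * c\<close>.\<close>

definition phase :: "real \<Rightarrow> real \<Rightarrow> 'a \<Rightarrow> complex" where
  "phase a t \<omega> = cis (a * displacement t \<omega>)"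

lemma abs_direction [simp]: "\<bar>direction t \<omega>\<bar> = 1"
  by (simp add: direction_def)

lemma direction_square [simp]: "direction t \<omega> * direction t \<omega> = 1"
  by (metis abs_direction abs_mult_self_eq mult_1)

lemma norm_phase [simp]: "norm (phase a t \<omega>) = 1"
  by (simp add: phase_def)

lemma measurable_N_max [measurable]: "N (max 0 t) \<in> M \<rightarrow>\<^sub>M count_space UNIV"
  by (rule measurable_N) simp

lemma measurable_direction [measurable]: "direction t \<in> borel_measurable M"
  unfolding direction_def by measurable

text \<open>Joint measurability follows from right-continuity: the process is a pointwise limit of
  processes whose time argument is rounded up to a grid. Fubini's theorem below rests on it.\<close>

lemma measurable_direction_pair [measurable]:
  "(\<lambda>(t, \<omega>). direction t \<omega>) \<in> borel_measurable (borel \<Otimes>\<^sub>M M)"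
proof -
  \<comment> \<open>Right end of the \<open>k\<close>-th cell of mesh \<open>1 / Suc n\<close>. The
    \<open>+ 1\<close> puts the rounded time strictly to the right of \<open>t\<close>, as a limit
    along \<open>at_right t\<close> requires.\<close>
  define q :: "nat \<Rightarrow> int \<Rightarrow> real" where "q n k = (real_of_int k + 1) / real (Suc n)" for n k
  define g where "g n t = q n \<lfloor>t * real (Suc n)\<rfloor>" for n t
  \<comment> \<open>The rounded time takes countably many values, so measurability at each fixed
    time suffices.\<close>
  have step: "(\<lambda>p. direction (g n (fst p)) (snd p)) \<in> borel_measurable (borel \<Otimes>\<^sub>M M)" for n
    unfolding g_def
    by (rule measurable_compose_countable[where f = "\<lambda>k p. direction (q n k) (snd p)"]) measurable
  have g_gt: "t < g n t" for n t
    unfolding g_def q_def by (simp add: pos_less_divide_eq) 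
  have g_le: "g n t \<le> t + 1 / real (Suc n)" for n t
  proof -
    have "g n t \<le> (t * real (Suc n) + 1) / real (Suc n)"
      unfolding g_def q_def by (intro divide_right_mono) auto
    then show ?thesis by (simp add: add_divide_distrib del: of_nat_Suc)
  qed
  have g_lim: "filterlim (\<lambda>n. g n t) (at_right t) sequentially" for t
  proof -
    have "(\<lambda>n. t + 1 / real (Suc n)) \<longlonglongrightarrow> t + 0"
      by (intro tendsto_intros LIMSEQ_Suc[OF lim_1_over_n])
    then have "(\<lambda>n. g n t) \<longlonglongrightarrow> t"
      by (intro real_tendsto_sandwich[OF _ _ tendsto_const[of t], of "\<lambda>n. g n t" sequentially
            "\<lambda>n. t + 1 / real (Suc n)"] always_eventually allI g_le less_imp_le[OF g_gt])
        (simp del: of_nat_Suc)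
    then show ?thesis
      using g_gt by (intro tendsto_imp_filterlim_at_right always_eventually) auto
  qed
  have lim: "(\<lambda>n. direction (g n t) \<omega>) \<longlonglongrightarrow> direction t \<omega>" if "\<omega> \<in> space M" for t \<omega>
  proof (cases "0 \<le> t")
    case True
    have "((\<lambda>s. N s \<omega>) \<longlongrightarrow> N t \<omega>) (at_right t)"
      using paths_right_continuous[OF that True] by (simp add: continuous_within)
    then have "(\<lambda>n. N (g n t) \<omega>) \<longlonglongrightarrow> N t \<omega>"
      using filterlim_compose g_lim by blast
    \<comment> \<open>In a discrete space a convergent sequence is eventually constant.\<close>
    then have "eventually (\<lambda>n. N (g n t) \<omega> = N t \<omega>) sequentially"
      by (simp add: tendsto_discrete)
    then have "eventually (\<lambda>n. direction (g n t) \<omega> = direction t \<omega>) sequentially"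
      by eventually_elim (use True g_gt in \<open>simp add: direction_def max_absorb2 less_imp_le order_less_imp_le[OF le_less_trans]\<close>)
    then show ?thesis by (simp add: tendsto_eventually)
  next
    case False
    \<comment> \<open>Before time \<open>0\<close> the truncation freezes the sign, and the rounded
      times are eventually negative as well.\<close>
    have "eventually (\<lambda>s. s < 0) (at_right t)"
      using False by (intro eventually_at_rightI[of _ 0]) auto
    then have "eventually (\<lambda>n. g n t < 0) sequentially"
      by (rule eventually_compose_filterlim[OF _ g_lim])
    then have "eventually (\<lambda>n. direction (g n t) \<omega> = direction t \<omega>) sequentially"
      by eventually_elim (use False in \<open>simp add: direction_def\<close>)
    then show ?thesis by (simp add: tendsto_eventually)
  qed
  have "(\<lambda>p. direction (fst p) (snd p)) \<in> borel_measurable (borel \<Otimes>\<^sub>M M)"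
    by (rule borel_measurable_LIMSEQ_metric[OF step]) (auto simp: space_pair_measure intro: lim)
  then show ?thesis by (simp add: case_prod_beta')
qed

lemma measurable_direction_path [measurable]:
  "\<omega> \<in> space M \<Longrightarrow> (\<lambda>t. direction t \<omega>) \<in> borel_measurable borel"
  by (rule measurable_Pair_compose_split[OF measurable_direction_pair]) measurable

lemma measurable_displacement_pair [measurable]:
  "(\<lambda>(t, \<omega>). displacement t \<omega>) \<in> borel_measurable (borel \<Otimes>\<^sub>M M)"
proof -
  \<comment> \<open>The upper limit varies with the pair, so the interval is written as a condition
    on \<open>s\<close> and \<open>p\<close> jointly.\<close>
  have "(\<lambda>p. LINT s|lborel. indicator {s. 0 \<le> s \<and> s \<le> fst p} s *\<^sub>R direction s (snd p))
      \<in> borel_measurable (borel \<Otimes>\<^sub>M M)"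
    by measurable
  then show ?thesis
    by (simp add: displacement_def set_lebesgue_integral_def case_prod_beta' atLeastAtMost_def
        atLeast_def atMost_def Collect_conj_eq)
qed

lemma measurable_displacement [measurable]: "displacement t \<in> borel_measurable M"
  using measurable_Pair_compose_split[OF measurable_displacement_pair, of "\<lambda>_. t" M "\<lambda>\<omega>. \<omega>"] by simp

lemma measurable_displacement_path [measurable]:
  "\<omega> \<in> space M \<Longrightarrow> (\<lambda>t. displacement t \<omega>) \<in> borel_measurable borel"
  by (rule measurable_Pair_compose_split[OF measurable_displacement_pair]) measurable

lemma measurable_phase_pair [measurable]:
  "(\<lambda>(t, \<omega>). phase a t \<omega>) \<in> borel_measurable (borel \<Otimes>\<^sub>M M)"
  unfolding phase_def cis_conv_exp by measurable

lemma measurable_phase [measurable]: "phase a t \<in> borel_measurable M"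
  unfolding phase_def cis_conv_exp by measurable

lemma measurable_phase_path [measurable]:
  "\<omega> \<in> space M \<Longrightarrow> (\<lambda>t. phase a t \<omega>) \<in> borel_measurable borel"
  unfolding phase_def cis_conv_exp by measurable

section \<open>Regularity of paths\<close>

lemma set_integrable_direction:
  "\<omega> \<in> space M \<Longrightarrow> set_integrable lborel {s..t} (\<lambda>r. direction r \<omega>)"
  by (rule set_integrable_bounded_Icc[where B = 1]) auto

lemma set_integrable_direction_phase:
  "\<omega> \<in> space M \<Longrightarrow> set_integrable lborel {s..t} (\<lambda>r. of_real (direction r \<omega>) * phase a r \<omega>)"
  by (rule set_integrable_bounded_Icc[where B = 1]) (measurable, simp add: norm_mult)

lemmas integrable_direction = set_borel_integral_eq_integral(1)[OF set_integrable_direction]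
lemmas integrable_direction_phase = set_borel_integral_eq_integral(1)[OF set_integrable_direction_phase]

lemma displacement_0 [simp]: "displacement 0 \<omega> = 0"
  unfolding displacement_def set_lebesgue_integral_def
  by (rule integral_eq_zero_AE, rule eventually_mono[OF AE_lborel_singleton[of 0]]) simp

lemma displacement_diff:
  assumes "\<omega> \<in> space M" "0 \<le> s" "s \<le> t"
  shows "displacement t \<omega> - displacement s \<omega> = integral {s..t} (\<lambda>r. direction r \<omega>)"
  using Henstock_Kurzweil_Integration.integral_combine[OF assms(2,3) integrable_direction[OF assms(1)]]
  unfolding displacement_def set_borel_integral_eq_integral(2)[OF set_integrable_direction[OF assms(1)]]
  by simp

lemma abs_displacement_diff_le:
  assumes "\<omega> \<in> space M" "0 \<le> s" "s \<le> t"
  shows "\<bar>displacement t \<omega> - displacement s \<omega>\<bar> \<le> t - s"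
  using has_integral_bound[OF _ integrable_integral[OF integrable_direction[OF assms(1), of s t],
        folded box_real(2)], of 1] assms(3)
  unfolding displacement_diff[OF assms] by simp

text \<open>Combines \<open>norm (cis x - 1) \<le> \<bar>x\<bar>\<close> with the unit speed of the
  displacement.\<close>

lemma norm_phase_diff_le:
  assumes "\<omega> \<in> space M" "0 \<le> s" "s \<le> t"
  shows "norm (phase a t \<omega> - phase a s \<omega>) \<le> \<bar>a\<bar> * (t - s)"
proof -
  let ?d = "displacement t \<omega> - displacement s \<omega>"
  have "phase a t \<omega> - phase a s \<omega> = phase a s \<omega> * (cis (a * ?d) - 1)"
    by (simp add: phase_def right_diff_distrib cis_mult)
  then have "norm (phase a t \<omega> - phase a s \<omega>) = norm (cis (a * ?d) - 1)"
    by (simp add: norm_mult)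
  also have "\<dots> \<le> \<bar>a * ?d\<bar>"
    using iexp_approx1[of "a * ?d" 0] by (simp add: cis_conv_exp)
  also have "\<dots> \<le> \<bar>a\<bar> * (t - s)"
    unfolding abs_mult by (intro mult_left_mono abs_displacement_diff_le assms) auto
  finally show ?thesis .
qed

text \<open>Monotonicity squeezes \<open>N r\<close> between two equal values, so equal counts at
  the ends mean no jump in between.\<close>

lemma direction_const:
  assumes "\<omega> \<in> space M" "0 \<le> s" "N s \<omega> = N t \<omega>" "r \<in> {s..t}"
  shows "direction r \<omega> = direction t \<omega>"
proof -
  have "N s \<omega> \<le> N r \<omega>" "N r \<omega> \<le> N t \<omega>"
    by (intro mono_onD[OF paths_mono[OF assms(1)]]; use assms in simp)+
  then show ?thesis using assms by (simp add: direction_def max_absorb2)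
qed

lemma displacement_const:
  assumes "\<omega> \<in> space M" "0 \<le> s" "N s \<omega> = N t \<omega>" "r \<in> {s..t}"
  shows "displacement r \<omega> = displacement s \<omega> + (r - s) * direction t \<omega>"
proof -
  have "integral {s..r} (\<lambda>u. direction u \<omega>) = integral {s..r} (\<lambda>u. direction t \<omega>)"
    using assms by (intro integral_cong direction_const[of \<omega> s t]) auto
  then show ?thesis
    using displacement_diff[of \<omega> s r] assms by simp
qed

section \<open>Path identities by grid approximation\<close>

text \<open>The endpoint rule is exact on a cell without jumps and off by at most
  \<open>2 * h\<close> on any other, so \<open>counting_grid_bound\<close> applies to the cell
  errors.\<close>

lemma riemann_sum_displacement:
  assumes \<omega>: "\<omega> \<in> space M" and h: "0 \<le> h"
  shows "\<bar>displacement (real m * h) \<omega> - h * (\<Sum>k<m. direction (real (Suc k) * h) \<omega>)\<bar>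
    \<le> 2 * h * real (N (real m * h) \<omega>)"
proof -
  define R where "R s t = displacement t \<omega> - displacement s \<omega> - (t - s) * direction t \<omega>" for s t
  have "norm (\<Sum>k<m. R (real k * h) (real (Suc k) * h)) \<le> 2 * h * real (N (real m * h) \<omega>)"
  proof (rule counting_grid_bound[OF paths_mono[OF \<omega>] h])
    fix s t :: real assume st: "0 \<le> s" "s \<le> t"
    show "R s t = 0" if "N s \<omega> = N t \<omega>"
      using displacement_const[OF \<omega> st(1) that, of t] st by (simp add: R_def)
    have "\<bar>R s t\<bar> \<le> \<bar>displacement t \<omega> - displacement s \<omega>\<bar> + \<bar>(t - s) * direction t \<omega>\<bar>"
      unfolding R_def by (rule abs_triangle_ineq4)
    also have "\<dots> \<le> (t - s) + (t - s)"
      using abs_displacement_diff_le[OF \<omega> st] st by (intro add_mono) (auto simp: abs_mult)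
    finally show "norm (R s t) \<le> 2 * (t - s)" by simp
  qed
  moreover have "(\<Sum>k<m. R (real k * h) (real (Suc k) * h))
      = displacement (real m * h) \<omega> - h * (\<Sum>k<m. direction (real (Suc k) * h) \<omega>)"
    using sum_lessThan_telescope[of "\<lambda>k. displacement (real k * h) \<omega>" m]
    by (simp add: R_def sum_distrib_left algebra_simps sum_subtractf sum.distrib)
  ultimately show ?thesis by simp
qed

lemma riemann_sum_displacement_tendsto:
  assumes \<omega>: "\<omega> \<in> space M" and t: "0 \<le> t"
  shows "(\<lambda>n. t / Suc n * (\<Sum>k<Suc n. direction (real (Suc k) * (t / Suc n)) \<omega>))
    \<longlonglongrightarrow> displacement t \<omega>"
proof (rule LIM_zero_cancel, rule Lim_null_comparison)
  show "eventually (\<lambda>n. norm (t / Suc n * (\<Sum>k<Suc n. direction (real (Suc k) * (t / Suc n)) \<omega>) - displacement t \<omega>)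
      \<le> 2 * t * real (N t \<omega>) * (1 / Suc n)) sequentially"
    using riemann_sum_displacement[OF \<omega>, of "t / Suc n" "Suc n" for n] t
    by (intro always_eventually allI) (simp add: abs_minus_commute del: of_nat_Suc sum.lessThan_Suc)
  show "(\<lambda>n. 2 * t * real (N t \<omega>) * (1 / Suc n)) \<longlonglongrightarrow> 0"
    by (intro tendsto_mult_right_zero LIMSEQ_Suc[OF lim_1_over_n])
qed

text \<open>The displacement may fail to be differentiable at jump times, so the fundamental theorem
  is applied only on jump-free intervals; the remaining cells contribute a total that vanishes with
  the mesh.\<close>

lemma phase_integral_equation:
  assumes \<omega>: "\<omega> \<in> space M" and t: "0 \<le> t"
  shows "phase a t \<omega> = 1 + \<i> * a * (LBINT s:{0..t}. of_real (direction s \<omega>) * phase a s \<omega>)"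
proof -
  define f where "f s = of_real (direction s \<omega>) * phase a s \<omega>" for s
  \<comment> \<open>The defect of the claimed equation; the goal is that it does not change from
    \<open>0\<close> to \<open>t\<close>.\<close>
  define F where "F s = phase a s \<omega> - \<i> * a * integral {0..s} f" for s
  have int: "f integrable_on {s..r}" for s r
    unfolding f_def by (rule integrable_direction_phase[OF \<omega>])
  have F_diff: "F r - F s = phase a r \<omega> - phase a s \<omega> - \<i> * a * integral {s..r} f" if "0 \<le> s" "s \<le> r" for s r
    using Henstock_Kurzweil_Integration.integral_combine[OF that int]
    by (simp add: F_def algebra_simps flip: distrib_left)
  have "norm (F t - F 0) \<le> 2 * \<bar>a\<bar> * t * real (N t \<omega>) * (1 / Suc m)" for m
  proof -
    let ?h = "t / Suc m"
    have "norm (\<Sum>k<Suc m. F (real (Suc k) * ?h) - F (real k * ?h)) \<le> 2 * \<bar>a\<bar> * ?h * real (N (real (Suc m) * ?h) \<omega>)"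
    proof (rule counting_grid_bound[OF paths_mono[OF \<omega>]])
      fix s r :: real assume sr: "0 \<le> s" "s \<le> r"
      show "F r - F s = 0" if "N s \<omega> = N r \<omega>"
      proof -
        let ?d = "direction r \<omega>"
        \<comment> \<open>Without jumps the displacement is affine with slope \<open>?d\<close>, so
          the phase has this explicit smooth form.\<close>
        let ?G = "\<lambda>u. cis (a * (displacement s \<omega> + (u - s) * ?d))"
        have G: "phase a u \<omega> = ?G u" if "u \<in> {s..r}" for u
          using displacement_const[OF \<omega> sr(1) \<open>N s \<omega> = N r \<omega>\<close> that] by (simp add: phase_def)
        have "((\<lambda>u. \<i> * a * (?d * ?G u)) has_integral (?G r - ?G s)) {s..r}"
        proof (rule fundamental_theorem_of_calculus[OF sr(2)])
          fix u
          have "(?G has_derivative (\<lambda>v. (v * (a * ?d)) *\<^sub>R (\<i> * ?G u))) (at u within {s..r})"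
            by (auto intro!: derivative_eq_intros simp: algebra_simps)
          then show "(?G has_vector_derivative \<i> * a * (?d * ?G u)) (at u within {s..r})"
            by (simp add: has_vector_derivative_def scaleR_conv_of_real algebra_simps)
        qed
        then have "((\<lambda>u. \<i> * a * f u) has_integral (phase a r \<omega> - phase a s \<omega>)) {s..r}"
          unfolding G[of r, OF atLeastAtMost_iff[THEN iffD2, OF conjI[OF sr(2) order_refl]]]
            G[of s, OF atLeastAtMost_iff[THEN iffD2, OF conjI[OF order_refl sr(2)]]]
          by (rule has_integral_eq[rotated]) (simp only: f_def G direction_const[OF \<omega> sr(1) that])
        then show ?thesis
          unfolding F_diff[OF sr] by (simp add: integral_unique flip: integral_mult_right)
      qed
      have "norm (integral {s..r} f) \<le> 1 * (r - s)"
        using has_integral_bound[OF _ integrable_integral[OF int[of s r], folded box_real(2)], of 1] sr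
        by (simp add: f_def norm_mult)
      then have "norm (\<i> * a * integral {s..r} f) \<le> \<bar>a\<bar> * (r - s)"
        by (simp add: norm_mult mult_left_mono)
      then have "norm (F r - F s) \<le> \<bar>a\<bar> * (r - s) + \<bar>a\<bar> * (r - s)"
        unfolding F_diff[OF sr]
        by (intro order_trans[OF norm_triangle_ineq4] add_mono norm_phase_diff_le \<omega> sr)
      then show "norm (F r - F s) \<le> 2 * \<bar>a\<bar> * (r - s)" by simp
    qed (use t in simp)
    then show ?thesis
      using sum_lessThan_telescope[of "\<lambda>k. F (real k * ?h)" "Suc m"] by (simp del: sum.lessThan_Suc of_nat_Suc)
  qed
  \<comment> \<open>For a fixed path the count \<open>N t \<omega>\<close> is a finite constant, so
    refining the grid sends the bound to zero.\<close>
  moreover have "(\<lambda>m. 2 * \<bar>a\<bar> * t * real (N t \<omega>) * (1 / Suc m)) \<longlonglongrightarrow> 2 * \<bar>a\<bar> * t * real (N t \<omega>) * 0"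
    by (intro tendsto_intros LIMSEQ_Suc[OF lim_1_over_n])
  ultimately have "norm (F t - F 0) \<le> 2 * \<bar>a\<bar> * t * real (N t \<omega>) * 0"
    by (intro LIMSEQ_le_const) auto
  then have "F t - F 0 = 0" by simp
  then show ?thesis
    using set_borel_integral_eq_integral(2)[OF set_integrable_direction_phase[OF \<omega>], of 0 t a]
    unfolding F_diff[OF order_refl t] by (simp add: f_def [abs_def] phase_def algebra_simps)
qed

section \<open>Expectations and independence of increments\<close>

text \<open>The function \<open>u\<close> of the overview: the characteristic function of the
  unit-speed displacement, evaluated at \<open>a\<close>.\<close>

definition mean_phase :: "real \<Rightarrow> real \<Rightarrow> complex" where
  "mean_phase a t = expectation (phase a t)"

text \<open>The function \<open>v\<close> of the overview. Since the squared sign is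
  \<open>1\<close>, it forms a closed linear system with \<open>u\<close>.\<close>

definition mean_direction_phase :: "real \<Rightarrow> real \<Rightarrow> complex" where
  "mean_direction_phase a t = expectation (\<lambda>\<omega>. of_real (direction t \<omega>) * phase a t \<omega>)"

lemma integrable_phase [simp]: "integrable M (phase a t)"
  by (rule integrable_const_bound[where B = 1]) auto

lemma mean_phase_0 [simp]: "mean_phase a 0 = 1"
  by (simp add: mean_phase_def phase_def [abs_def] prob_space)

lemma mean_direction_phase_0: "mean_direction_phase a 0 = 1"
proof -
  have "mean_direction_phase a 0 = expectation (\<lambda>_. 1)"
    unfolding mean_direction_phase_def
    by (rule Bochner_Integration.integral_cong) (simp_all add: direction_def phase_def N_0)
  then show ?thesis by (simp add: prob_space)
qed

lemma measurable_increment [measurable]: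
  "0 \<le> s \<Longrightarrow> 0 \<le> t \<Longrightarrow> (\<lambda>\<omega>. N t \<omega> - N s \<omega>) \<in> M \<rightarrow>\<^sub>M count_space UNIV"
  using measurable_N_max[of s] measurable_N_max[of t] by (simp add: max_absorb2)

lemma expectation_increment_sign:
  assumes "0 \<le> s" "s < t"
  shows "expectation (\<lambda>\<omega>. (-1) ^ (N t \<omega> - N s \<omega>)) = (exp (- (2 * rate * (t - s))) :: complex)"
proof -
  have "expectation (\<lambda>\<omega>. (-1) ^ (N t \<omega> - N s \<omega>))
      = (\<integral>k. (-1) ^ k \<partial>distr M (count_space UNIV) (\<lambda>\<omega>. N t \<omega> - N s \<omega>) :: complex)"
    using assms by (intro integral_distr[symmetric]) auto
  also have "\<dots> = exp (- (2 * (rate * (t - s))))"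
    unfolding increments_poisson[OF assms]
    using assms rate_pos by (intro expectation_minus_one_power_poisson) simp
  finally show ?thesis by (simp add: mult.assoc)
qed

text \<open>Separates the past, seen through finitely many grid increments up to
  \<open>real m * h\<close>, from the single increment that follows up to \<open>t\<close>.\<close>

lemma indep_grid_increment:
  fixes f :: "(nat \<Rightarrow> nat) \<Rightarrow> complex" and g :: "nat \<Rightarrow> complex"
  assumes h: "0 < h" and t: "real m * h < t"
    and f: "f \<in> borel_measurable (PiM {..<m} (\<lambda>_. count_space UNIV))"
    and fB: "\<And>x. norm (f x) \<le> 1" and gB: "\<And>x. norm (g x) \<le> 1"
  defines "X \<equiv> (\<lambda>\<omega>. \<lambda>k\<in>{..<m}. N (real (Suc k) * h) \<omega> - N (real k * h) \<omega>)"
    and "Y \<equiv> (\<lambda>\<omega>. N t \<omega> - N (real m * h) \<omega>)"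
  shows "expectation (\<lambda>\<omega>. f (X \<omega>) * g (Y \<omega>)) = expectation (\<lambda>\<omega>. f (X \<omega>)) * expectation (\<lambda>\<omega>. g (Y \<omega>))"
proof -
  \<comment> \<open>The regular grid with \<open>t\<close> appended as node \<open>Suc m\<close>;
    its last cell may have any positive length. The past is then the block \<open>{..<m}\<close> of
    increments and the future the index \<open>m\<close>.\<close>
  define \<tau> where "\<tau> k = (if k \<le> m then real k * h else t)" for k
  define D where "D k \<omega> = N (\<tau> (Suc k)) \<omega> - N (\<tau> k) \<omega>" for k \<omega>
  have "strict_mono_on {..Suc m} \<tau>"
  proof (rule strict_mono_onI)
    fix i j assume ij: "i \<in> {..Suc m}" "j \<in> {..Suc m}" "i < j"
    have "real i * h \<le> real m * h" using ij h by (intro mult_right_mono) auto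
    with t have "real i * h < t" by linarith
    then show "\<tau> i < \<tau> j" using ij h t by (auto simp: \<tau>_def)
  qed
  then have "indep_vars (\<lambda>_. count_space UNIV) D {..<Suc m}"
    unfolding D_def by (rule increments_indep[rotated]) (simp add: \<tau>_def)
  then have "indep_var (PiM {..<m} (\<lambda>_. count_space UNIV)) (\<lambda>\<omega>. \<lambda>k\<in>{..<m}. D k \<omega>)
      (PiM {m} (\<lambda>_. count_space UNIV)) (\<lambda>\<omega>. \<lambda>k\<in>{m}. D k \<omega>)"
    by (rule indep_var_restrict) auto
  then have "indep_var borel (f \<circ> (\<lambda>\<omega>. \<lambda>k\<in>{..<m}. D k \<omega>)) borel ((\<lambda>x. g (x m)) \<circ> (\<lambda>\<omega>. \<lambda>k\<in>{m}. D k \<omega>))"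
    by (rule indep_var_compose[OF _ f]) measurable
  moreover have "f \<circ> (\<lambda>\<omega>. \<lambda>k\<in>{..<m}. D k \<omega>) = (\<lambda>\<omega>. f (X \<omega>))"
    by (auto simp: X_def D_def \<tau>_def intro!: ext arg_cong[where f = f])
  moreover have "(\<lambda>x. g (x m)) \<circ> (\<lambda>\<omega>. \<lambda>k\<in>{m}. D k \<omega>) = (\<lambda>\<omega>. g (Y \<omega>))"
    by (auto simp: Y_def D_def \<tau>_def)
  ultimately have ind: "indep_var borel (\<lambda>\<omega>. f (X \<omega>)) borel (\<lambda>\<omega>. g (Y \<omega>))"
    by simp
  show ?thesis
    using fB gB indep_var_rv1[OF ind] indep_var_rv2[OF ind]
    by (intro indep_var_lebesgue_integral ind integrable_const_bound[where B = 1]) auto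
qed

text \<open>The product of the two signs is the parity of the increment after \<open>s\<close>,
  which is independent of the phase at \<open>s\<close>; its mean is the exponential factor.\<close>

lemma expectation_direction_direction_phase:
  assumes s: "0 \<le> s" "s \<le> t"
  shows "expectation (\<lambda>\<omega>. of_real (direction t \<omega>) * (of_real (direction s \<omega>) * phase a s \<omega>))
    = exp (- (2 * rate * (t - s))) * mean_phase a s"
\<comment> \<open>The Poisson law and the independence of increments are stated for strictly
  increasing times; at equal times the signs cancel.\<close>
proof (cases "s = t")
  case True
  then show ?thesis
    by (simp add: mean_phase_def flip: mult.assoc of_real_mult)
next
  case False
  \<comment> \<open>Riemann sums involve finitely many increments up to \<open>s\<close>, hence are independent of \<open>N t - N s\<close>.\<close>
  define S where "S n \<omega> = s / Suc n * (\<Sum>k<Suc n. direction (real (Suc k) * (s / Suc n)) \<omega>)" for n \<omega>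
  define Z where "Z \<omega> = (-1 :: complex) ^ (N t \<omega> - N s \<omega>)" for \<omega>
  have [measurable]: "(\<lambda>\<omega>. N t \<omega> - N s \<omega>) \<in> M \<rightarrow>\<^sub>M count_space UNIV"
    using s by (intro measurable_increment) auto
  have [measurable]: "Z \<in> borel_measurable M"
    unfolding Z_def by measurable
  have [measurable]: "S n \<in> borel_measurable M" for n
    unfolding S_def by (intro borel_measurable_times borel_measurable_sum measurable_direction) simp
  \<comment> \<open>\<open>N t + N s\<close> and \<open>N t - N s\<close> differ by the even number
    \<open>2 * N s\<close>; monotone paths make the subtraction genuine.\<close>
  have Z: "of_real (direction t \<omega>) * of_real (direction s \<omega>) = Z \<omega>" if "\<omega> \<in> space M" for \<omega>
  proof -
    have "N s \<omega> \<le> N t \<omega>" by (intro mono_onD[OF paths_mono[OF that]]; use s in simp)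
    then have "N t \<omega> = (N t \<omega> - N s \<omega>) + N s \<omega>" by simp
    then have "(-1 :: complex) ^ N t \<omega> * (-1) ^ N s \<omega> = Z \<omega>"
      unfolding Z_def by (metis (no_types) mult.assoc power_add power_mult_distrib mult_minus1_right minus_minus mult_1_right power_one)
    then show ?thesis using s by (simp add: direction_def max_absorb2)
  qed
  have split: "expectation (\<lambda>\<omega>. cis (a * S n \<omega>) * Z \<omega>) = expectation (\<lambda>\<omega>. cis (a * S n \<omega>)) * expectation Z" for n
  \<comment> \<open>At \<open>s = 0\<close> the grid degenerates, but the Riemann sum is then
    \<open>0\<close> and the factor \<open>cis\<close> equals \<open>1\<close>.\<close>
  proof (cases "s = 0")
    case True
    then show ?thesis by (simp add: S_def prob_space)
  next
    case False
    define h where "h = s / Suc n"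
    have h: "0 < h" and mh: "real (Suc n) * h = s" using False s by (auto simp: h_def)
    \<comment> \<open>Reconstructs the Riemann sum from the increments: the count at node
      \<open>Suc k\<close> is the sum of the first \<open>Suc k\<close> increments, because the
      process starts at \<open>0\<close>.\<close>
    let ?f = "\<lambda>x :: nat \<Rightarrow> nat. cis (a * (h * (\<Sum>k<Suc n. (-1) ^ (\<Sum>j<Suc k. x j))))"
    let ?X = "\<lambda>\<omega>. \<lambda>k\<in>{..<Suc n}. N (real (Suc k) * h) \<omega> - N (real k * h) \<omega>"
    have "(\<lambda>x. (\<Sum>j<Suc k. x j)) \<in> PiM {..<Suc n} (\<lambda>_. count_space UNIV) \<rightarrow>\<^sub>M count_space (UNIV :: nat set)" if "k < Suc n" for k
      by (rule measurable_sum_nat) (use that in \<open>auto intro!: measurable_component_singleton\<close>)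
    from measurable_compose[OF this, of _ "\<lambda>k. (-1) ^ k" borel]
    have [measurable]: "(\<lambda>x. \<Sum>k<Suc n. (-1 :: real) ^ (\<Sum>j<Suc k. x j)) \<in> borel_measurable (PiM {..<Suc n} (\<lambda>_. count_space UNIV))"
      by (intro borel_measurable_sum) (simp del: sum.lessThan_Suc)
    have f: "?f \<in> borel_measurable (PiM {..<Suc n} (\<lambda>_. count_space UNIV))"
      unfolding cis_conv_exp by measurable
    have X: "cis (a * S n \<omega>) = ?f (?X \<omega>)" if \<omega>: "\<omega> \<in> space M" for \<omega>
    proof -
      have "(\<Sum>j<k. N (real (Suc j) * h) \<omega> - N (real j * h) \<omega>) = N (real k * h) \<omega>" for k
      proof (induction k)
        case (Suc k)
        have "N (real k * h) \<omega> \<le> N (real (Suc k) * h) \<omega>"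
          by (intro mono_onD[OF paths_mono[OF \<omega>]]; use h in \<open>simp add: mult_right_mono\<close>)
        then show ?case using Suc by simp
      qed (simp add: N_0 \<omega>)
      then have "(\<Sum>j<Suc k. ?X \<omega> j) = N (real (Suc k) * h) \<omega>" if "k < Suc n" for k
        using that by (subst sum.cong[OF refl, of _ _ "\<lambda>j. N (real (Suc j) * h) \<omega> - N (real j * h) \<omega>"]) auto
      then have "(\<Sum>k<Suc n. (-1) ^ (\<Sum>j<Suc k. ?X \<omega> j)) = (\<Sum>k<Suc n. direction (real (Suc k) * h) \<omega>)"
        using h by (intro sum.cong) (auto simp: direction_def max_absorb2 simp del: sum.lessThan_Suc of_nat_Suc)
      then show ?thesis unfolding S_def h_def by simp
    qed
    have "expectation (\<lambda>\<omega>. ?f (?X \<omega>) * (-1) ^ (N t \<omega> - N (real (Suc n) * h) \<omega>))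
        = expectation (\<lambda>\<omega>. ?f (?X \<omega>)) * expectation (\<lambda>\<omega>. (-1) ^ (N t \<omega> - N (real (Suc n) * h) \<omega>))"
      by (rule indep_grid_increment[OF h _ f]) (use s \<open>s \<noteq> t\<close> in \<open>auto simp: mh norm_power simp del: of_nat_Suc\<close>)
    then show ?thesis
      unfolding mh Z_def by (simp only: X cong: Bochner_Integration.integral_cong)
  qed
  have lim: "(\<lambda>n. cis (a * S n \<omega>)) \<longlonglongrightarrow> phase a s \<omega>" if "\<omega> \<in> space M" for \<omega>
    unfolding phase_def cis_conv_exp S_def
    by (intro tendsto_intros riemann_sum_displacement_tendsto that s)
  have m: "(\<lambda>\<omega>. cis (a * S n \<omega>)) \<in> borel_measurable M" for n
    unfolding cis_conv_exp by measurable
  \<comment> \<open>All factors have modulus \<open>1\<close>, so dominated convergence carries the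
    factorization from the Riemann sums to the phase.\<close>
  have "(\<lambda>n. expectation (\<lambda>\<omega>. cis (a * S n \<omega>) * Z \<omega>)) \<longlonglongrightarrow> expectation (\<lambda>\<omega>. phase a s \<omega> * Z \<omega>)"
    by (rule integral_dominated_convergence[where w = "\<lambda>_. 1"])
      (auto intro!: AE_I2 tendsto_intros lim borel_measurable_times m simp: norm_mult Z_def norm_power)
  moreover have "(\<lambda>n. expectation (\<lambda>\<omega>. cis (a * S n \<omega>)) * expectation Z) \<longlonglongrightarrow> expectation (phase a s) * expectation Z"
    by (intro tendsto_intros integral_dominated_convergence[where w = "\<lambda>_. 1"])
      (auto intro!: AE_I2 lim m)
  ultimately have "expectation (\<lambda>\<omega>. phase a s \<omega> * Z \<omega>) = expectation (phase a s) * expectation Z"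
    unfolding split by (rule LIMSEQ_unique)
  moreover have "expectation Z = exp (- (2 * rate * (t - s)))"
    using expectation_increment_sign[of s t] s False by (simp add: Z_def [abs_def])
  moreover have "expectation (\<lambda>\<omega>. of_real (direction t \<omega>) * (of_real (direction s \<omega>) * phase a s \<omega>))
      = expectation (\<lambda>\<omega>. phase a s \<omega> * Z \<omega>)"
    by (rule Bochner_Integration.integral_cong) (simp_all only: Z[symmetric] mult_ac)
  ultimately show ?thesis by (simp add: mean_phase_def mult.commute)
qed

section \<open>Integral equations for the means\<close>

text \<open>Fubini's theorem: a bounded jointly measurable integrand is integrable over a strip of
  finite product measure.\<close>

lemma expectation_set_integral:
  fixes g :: "real \<Rightarrow> 'a \<Rightarrow> complex"
  assumes g [measurable]: "(\<lambda>(s, \<omega>). g s \<omega>) \<in> borel_measurable (borel \<Otimes>\<^sub>M M)"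
    and B: "\<And>s \<omega>. norm (g s \<omega>) \<le> B"
  shows "expectation (\<lambda>\<omega>. LBINT s:{0..t}. g s \<omega>) = (LBINT s:{0..t}. expectation (g s))" (is ?eq)
    and "integrable M (\<lambda>\<omega>. LBINT s:{0..t}. g s \<omega>)" (is ?int)
proof -
  have fin: "emeasure (lborel \<Otimes>\<^sub>M M) ({0..t} \<times> space M) < \<infinity>"
    by (subst emeasure_pair_measure_Times) (auto simp: emeasure_lborel_Icc_eq emeasure_space_1)
  interpret pair_sigma_finite lborel M ..
  from fin have "integrable (lborel \<Otimes>\<^sub>M M) (\<lambda>p. indicator ({0..t} \<times> space M) p * B)"
    by (intro integrable_mult_left integrable_real_indicator) auto
  then have *: "integrable (lborel \<Otimes>\<^sub>M M) (\<lambda>(s, \<omega>). indicator {0..t} s *\<^sub>R g s \<omega>)"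
    by (rule Bochner_Integration.integrable_bound)
      (use B order_trans[OF norm_ge_zero B] in \<open>auto simp: indicator_def space_pair_measure intro!: AE_I2\<close>)
  show ?int using integrable_snd[OF *] by (simp add: set_lebesgue_integral_def)
  show ?eq using Fubini_integral[OF *] by (simp add: set_lebesgue_integral_def)
qed

lemma mean_phase_eq:
  assumes "0 \<le> t"
  shows "mean_phase a t = 1 + \<i> * a * (LBINT s:{0..t}. mean_direction_phase a s)"
proof -
  let ?g = "\<lambda>s \<omega>. of_real (direction s \<omega>) * phase a s \<omega>"
  have g: "(\<lambda>(s, \<omega>). ?g s \<omega>) \<in> borel_measurable (borel \<Otimes>\<^sub>M M)" "\<And>s \<omega>. norm (?g s \<omega>) \<le> 1"
    by (measurable, simp add: norm_mult)
  have "mean_phase a t = expectation (\<lambda>\<omega>. 1 + \<i> * a * (LBINT s:{0..t}. ?g s \<omega>))"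
    unfolding mean_phase_def
    by (rule Bochner_Integration.integral_cong) (simp_all add: phase_integral_equation assms)
  then show ?thesis
    using expectation_set_integral[OF g, of t] by (simp add: prob_space mean_direction_phase_def)
qed

text \<open>Obtained by multiplying the path equation by the sign at \<open>t\<close> and averaging.
  The result has variation-of-constants form, so the product rule will differentiate it.\<close>

lemma mean_direction_phase_eq:
  assumes t: "0 \<le> t"
  shows "mean_direction_phase a t = exp (- (2 * rate * t)) *
    (1 + \<i> * a * (LBINT s:{0..t}. exp (2 * rate * s) * mean_phase a s))"
proof -
  let ?g = "\<lambda>s \<omega>. of_real (direction t \<omega>) * (of_real (direction s \<omega>) * phase a s \<omega>)"
  have g: "(\<lambda>(s, \<omega>). ?g s \<omega>) \<in> borel_measurable (borel \<Otimes>\<^sub>M M)" "\<And>s \<omega>. norm (?g s \<omega>) \<le> 1"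
    by (measurable, simp add: norm_mult)
  have int: "integrable M (\<lambda>\<omega>. complex_of_real (direction t \<omega>))"
    by (rule integrable_const_bound[where B = 1]) auto
  \<comment> \<open>The mean sign is the two-time formula at earlier time \<open>0\<close> with
    frequency \<open>0\<close>, where the phase and the initial sign are both
    \<open>1\<close>.\<close>
  have "expectation (\<lambda>\<omega>. of_real (direction t \<omega>) * (of_real (direction 0 \<omega>) * phase 0 0 \<omega>)) = expectation (\<lambda>\<omega>. complex_of_real (direction t \<omega>))"
    by (rule Bochner_Integration.integral_cong) (simp_all add: phase_def direction_def N_0)
  then have dir: "expectation (\<lambda>\<omega>. complex_of_real (direction t \<omega>)) = exp (- (2 * rate * t))"
    using expectation_direction_direction_phase[OF order_refl t, of 0] by simp
  have "mean_direction_phase a t = expectation (\<lambda>\<omega>. of_real (direction t \<omega>) + \<i> * a * (LBINT s:{0..t}. ?g s \<omega>))"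
    unfolding mean_direction_phase_def
  proof (rule Bochner_Integration.integral_cong[OF refl])
    fix \<omega> assume \<omega>: "\<omega> \<in> space M"
    have "(LBINT s:{0..t}. ?g s \<omega>)
        = of_real (direction t \<omega>) * (LBINT s:{0..t}. of_real (direction s \<omega>) * phase a s \<omega>)"
      by (rule set_integral_mult_right)
    then show "of_real (direction t \<omega>) * phase a t \<omega>
        = of_real (direction t \<omega>) + \<i> * a * (LBINT s:{0..t}. ?g s \<omega>)"
      by (simp only: phase_integral_equation[OF \<omega> t]) (simp only: distrib_left mult_1_right mult.left_commute)
  qed
  also have "\<dots> = exp (- (2 * rate * t)) + \<i> * a * (LBINT s:{0..t}. expectation (?g s))"
    using expectation_set_integral[OF g, of t] int by (simp add: dir del: integral_complex_of_real)
  also have "(LBINT s:{0..t}. expectation (?g s))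
      = (LBINT s:{0..t}. exp (- (2 * rate * t)) * (exp (2 * rate * s) * mean_phase a s))"
  proof (rule set_lebesgue_integral_cong, simp, intro allI impI)
    fix s assume s: "s \<in> {0..t}"
    \<comment> \<open>Splitting the exponential frees the integrand of \<open>t\<close>, so that
      \<open>t\<close> remains only in a prefactor and in the upper limit.\<close>
    have "exp (- (2 * rate * (t - s))) = exp (- (2 * rate * t)) * exp (2 * rate * s)"
      by (simp add: algebra_simps flip: exp_add)
    then show "expectation (?g s) = exp (- (2 * rate * t)) * (exp (2 * rate * s) * mean_phase a s)"
      using s by (simp add: expectation_direction_direction_phase mult.assoc)
  qed
  finally show ?thesis
    unfolding set_integral_mult_right by (simp only: distrib_left mult_1_right mult.left_commute)
qed

section \<open>Regularity in time and the first-order system\<close>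

text \<open>The Lipschitz bound of the paths passes to the mean. This starts the bootstrap:
  \<open>u\<close> continuous makes \<open>v\<close> differentiable, hence continuous, which makes
  \<open>u\<close> differentiable.\<close>

lemma continuous_mean_phase: "continuous_on {0..} (mean_phase a)"
proof (rule lipschitz_on_continuous_on[OF lipschitz_onI])
  have *: "dist (mean_phase a s) (mean_phase a t) \<le> \<bar>a\<bar> * dist s t" if st: "0 \<le> s" "s \<le> t" for s t
  proof -
    have "mean_phase a t - mean_phase a s = expectation (\<lambda>\<omega>. phase a t \<omega> - phase a s \<omega>)"
      by (simp add: mean_phase_def)
    also have "norm \<dots> \<le> expectation (\<lambda>\<omega>. norm (phase a t \<omega> - phase a s \<omega>))"
      by (rule integral_norm_bound)
    also have "\<dots> \<le> expectation (\<lambda>\<omega>. \<bar>a\<bar> * (t - s))"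
      by (intro integral_mono norm_phase_diff_le st) auto
    finally show ?thesis using st by (simp add: prob_space dist_norm norm_minus_commute)
  qed
  show "dist (mean_phase a s) (mean_phase a t) \<le> \<bar>a\<bar> * dist s t" if "s \<in> {0..}" "t \<in> {0..}" for s t
    using *[of s t] *[of t s] that by (cases "s \<le> t") (auto simp: dist_commute)
qed simp

end

lemma has_vector_derivative_set_integral:
  fixes f :: "real \<Rightarrow> complex"
  assumes "continuous_on {0..} f" "0 \<le> t"
  shows "((\<lambda>t. LBINT s:{0..t}. f s) has_vector_derivative f t) (at t within {0..})"
proof -
  have cont: "continuous_on {0..r} f" for r
    by (rule continuous_on_subset[OF assms(1)]) auto
  \<comment> \<open>The interval up to \<open>t + 1\<close> is compact yet agrees with
    \<open>{0..}\<close> near \<open>t\<close>, which also gives the one-sided derivative at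
    \<open>0\<close>.\<close>
  have "((\<lambda>r. integral {0..r} f) has_vector_derivative f t) (at t within {0..t + 1})"
    by (rule integral_has_vector_derivative[OF cont]) (use assms in auto)
  moreover have "(\<lambda>r. integral {0..r} f) = (\<lambda>r. LBINT s:{0..r}. f s)"
    by (simp add: set_borel_integral_eq_integral(2)[OF borel_integrable_atLeastAtMost'[OF cont]])
  moreover have "at t within {0..t + 1} = at t within {0..}"
    by (rule at_within_nhd[of _ "{..<t + 1}"]) auto
  ultimately show ?thesis by simp
qed

context poisson_process
begin

lemma mean_direction_phase_derivative:
  assumes t: "0 \<le> t"
  shows "(mean_direction_phase a has_vector_derivative
    \<i> * a * mean_phase a t - 2 * rate * mean_direction_phase a t) (at t within {0..})"
proof -
  let ?J = "\<lambda>t. LBINT s:{0..t}. exp (2 * rate * s) * mean_phase a s"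
  have "continuous_on {0..} (\<lambda>s. complex_of_real (exp (2 * rate * s)) * mean_phase a s)"
    by (intro continuous_intros continuous_mean_phase)
  then have J: "(?J has_vector_derivative exp (2 * rate * t) * mean_phase a t) (at t within {0..})"
    using t by (rule has_vector_derivative_set_integral)
  have "((\<lambda>t. exp (- (2 * rate * t))) has_real_derivative - (2 * rate) * exp (- (2 * rate * t))) (at t within {0..})"
    by (auto intro!: derivative_eq_intros)
  then have E: "((\<lambda>t. complex_of_real (exp (- (2 * rate * t)))) has_vector_derivative
      complex_of_real (- (2 * rate) * exp (- (2 * rate * t)))) (at t within {0..})"
    by (intro has_vector_derivative_of_real) (simp add: has_real_derivative_iff_has_vector_derivative)
  have "((\<lambda>t. exp (- (2 * rate * t)) * (1 + \<i> * a * ?J t)) has_vector_derivative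
      exp (- (2 * rate * t)) * (\<i> * a * (exp (2 * rate * t) * mean_phase a t))
      + complex_of_real (- (2 * rate) * exp (- (2 * rate * t))) * (1 + \<i> * a * ?J t)) (at t within {0..})"
    using has_vector_derivative_mult[OF E has_vector_derivative_add[OF has_vector_derivative_const[of 1]
          has_vector_derivative_mult_right[OF J, of "\<i> * a"]]] by simp
  also have "exp (- (2 * rate * t)) * (\<i> * a * (exp (2 * rate * t) * mean_phase a t)) = \<i> * a * mean_phase a t"
    by (simp add: exp_minus)
  also have "\<i> * a * mean_phase a t + complex_of_real (- (2 * rate) * exp (- (2 * rate * t))) * (1 + \<i> * a * ?J t)
      = \<i> * a * mean_phase a t - 2 * rate * mean_direction_phase a t"
    unfolding mean_direction_phase_eq[OF t] by (simp add: algebra_simps)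
  finally show ?thesis
    by (rule has_vector_derivative_transform[rotated 2]) (use t in \<open>simp_all add: mean_direction_phase_eq\<close>)
qed

lemma mean_phase_derivative:
  assumes t: "0 \<le> t"
  shows "(mean_phase a has_vector_derivative \<i> * a * mean_direction_phase a t) (at t within {0..})"
proof -
  have "continuous_on {0..} (mean_direction_phase a)"
    unfolding continuous_on_eq_continuous_within
    using mean_direction_phase_derivative by (auto intro: has_vector_derivative_continuous)
  from has_vector_derivative_add[OF has_vector_derivative_const[of 1]
      has_vector_derivative_mult_right[OF has_vector_derivative_set_integral[OF this t], of "\<i> * a"]]
  have "((\<lambda>t. 1 + \<i> * a * (LBINT s:{0..t}. mean_direction_phase a s)) has_vector_derivative
      \<i> * a * mean_direction_phase a t) (at t within {0..})"
    by simp
  then show ?thesis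
    by (rule has_vector_derivative_transform[rotated 2]) (use t in \<open>simp_all add: mean_phase_eq\<close>)
qed

section \<open>Return to the Kac model and its Cauchy problem\<close>

text \<open>On \<open>{0..t}\<close> the truncation is invisible and the cosine of
  \<open>pi * N\<close> is the sign; for negative \<open>t\<close> the interval is empty on both
  sides.\<close>

lemma kac_char_eq_mean_phase: "kac_char M c N \<beta> t = mean_phase (\<beta> * c) t"
proof -
  have "kac_position c N t \<omega> = displacement t \<omega> * c" for \<omega>
  proof -
    have "kac_position c N t \<omega> = (LBINT s:{0..t}. direction s \<omega> * c)"
      unfolding kac_position_eq
      by (rule set_lebesgue_integral_cong) (auto simp: direction_def max_absorb2 cos_npi2)
    then show ?thesis by (simp add: displacement_def)
  qed
  then show ?thesis
    by (simp add: kac_char_def mean_phase_def phase_def [abs_def] cis_conv_exp mult_ac)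
qed

end

theorem theorem2:
  fixes M :: "'a measure" and N :: "real \<Rightarrow> 'a \<Rightarrow> nat" and c lam \<beta> :: real
  assumes "0 < c" and "0 < lam"
    and "poisson_process M lam N"
  shows "\<exists>I' I'' :: real \<Rightarrow> complex.
      (\<forall>t\<ge>0. (kac_char M c N \<beta> has_vector_derivative I' t) (at t within {0..})) \<and>
      (\<forall>t\<ge>0. (I' has_vector_derivative I'' t) (at t within {0..})) \<and>
      (\<forall>t\<ge>0. I'' t + 2 * of_real lam * I' t + of_real (c\<^sup>2 * \<beta>\<^sup>2) * kac_char M c N \<beta> t = 0) \<and>
      kac_char M c N \<beta> 0 = 1 \<and> I' 0 = \<i> * of_real c * of_real \<beta>"
proof -
  interpret poisson_process M lam N by fact
  define a where "a = \<beta> * c"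
  have I: "kac_char M c N \<beta> = mean_phase a"
    by (rule ext) (simp add: kac_char_eq_mean_phase a_def)
  show ?thesis
    unfolding I
  proof (intro exI conjI allI impI)
    fix t :: real assume t: "0 \<le> t"
    \<comment> \<open>The witnesses come from the first-order system: \<open>I' = \<i> a v\<close>,
      and \<open>I''\<close> is \<open>\<i> a\<close> times the derivative of
      \<open>v\<close>.\<close>
    show "(mean_phase a has_vector_derivative \<i> * a * mean_direction_phase a t) (at t within {0..})"
      using t by (rule mean_phase_derivative)
    show "((\<lambda>t. \<i> * a * mean_direction_phase a t) has_vector_derivative
        \<i> * a * (\<i> * a * mean_phase a t - 2 * lam * mean_direction_phase a t)) (at t within {0..})"
      by (rule has_vector_derivative_mult_right[OF mean_direction_phase_derivative[OF t]])
    \<comment> \<open>The damping terms cancel, and \<open>(\<i> * a)^2\<close> is minus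
      \<open>c^2 * \<beta>^2\<close>.\<close>
    show "\<i> * a * (\<i> * a * mean_phase a t - 2 * lam * mean_direction_phase a t)
        + 2 * of_real lam * (\<i> * a * mean_direction_phase a t) + of_real (c\<^sup>2 * \<beta>\<^sup>2) * mean_phase a t = 0"
      by (simp add: a_def algebra_simps power2_eq_square)
  next
    show "mean_phase a 0 = 1"
      by (rule mean_phase_0)
    show "\<i> * a * mean_direction_phase a 0 = \<i> * of_real c * of_real \<beta>"
      by (simp add: a_def mean_direction_phase_0)
  qed
qed

end
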